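(* Let $m$ and $n$ be positive integers, $q=2^m$, $\gamma\in\mathbb{F}_{q^n}$ and $c_1,c_2\in\mathbb{F}_q$. Let $f(X)=X+\gamma\,\mathrm{Tr}_{q}^{q^n}\left(c_1X+c_2X^2+X^2\,\mathrm{Tr}_{q}^{q^n}(X)\right)\in\mathbb{F}_{q^n}[X]$. Then the compositional inverse of $f$ over $\mathbb{F}_{q^n}$ is \[ f^{-1}(X)=\begin{cases} f(X) & \text{if } \mathrm{Tr}_{q}^{q^n}(\gamma)=0,\\ g(X) & \text{if } \mathrm{Tr}_{q}^{q^n}(\gamma)(c_1+c_2^2)=1 \text{ and } m \text{ is odd},\end{cases} \] where \[ \begin{aligned} g(X)=\;&\mathrm{Tr}_{q}^{q^n}((1+\gamma)X)+\gamma\left((c_1+c_2^2)\mathrm{Tr}_{q}^{q^n}(X)+c_2^3\right)^t+\gamma c_2+\sum_{\substack{1\le i,j\le n-1\\ i\neq j}}\gamma^{q^i}X^{q^j}\\ &+\sum_{j=1}^{n-1}\left(\frac{1}{c_1+c_2^2}+1\right)X^{q^j}+\left(\left(\frac{1}{c_1+c_2^2}+1\right)\sum_{j=1}^{n-1}\gamma^{q^j}+\frac{c_1+c_2^2+1}{(c_1+c_2^2)^2}\right)\\ &\cdot\left((c_1+c_2^2)\left((c_1+c_2^2)\mathrm{Tr}_{q}^{q^n}(X)+c_2^3\right)^t+(c_1+c_2^2)\mathrm{Tr}_{q}^{q^n}(X)+c_2^3+c_1c_2\right) \end{aligned} \] and $t$ is a positive integer such that $3t\equiv 1\pmod{2^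m-1}$.
   Context: For a prime power $q$, $\mathbb{F}_q$ is the finite field with $q$ elements. $\mathrm{Tr}_{q}^{q^n}(x)=x+x^q+\cdots+x^{q^{n-1}}$ is the relative trace from $\mathbb{F}_{q^n}$ to $\mathbb{F}_q$. The compositional inverse $f^{-1}$ of a permutation polynomial $f$ over $\mathbb{F}_Q$ (a polynomial inducing a bijection of $\mathbb{F}_Q$) is the polynomial, unique modulo $X^{Q}-X$, with $f^{-1}(f(X))\equiv f(f^{-1}(X))\equiv X\pmod{X^{Q}-X}$; polynomials are identified with the functions on $\mathbb{F}_Q$ they induce. Empty sums are zero. *)

theory Defs
  imports "HOL-Number_Theory.Cong" "HOL-Computational_Algebra.Polynomial" "HOL-Library.Cardinality"
begin

definition is_subfield :: "'a::field set \<Rightarrow> bool" where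
  "is_subfield K \<longleftrightarrow> 0 \<in> K \<and> 1 \<in> K \<and>
     (\<forall>x\<in>K. \<forall>y\<in>K. x + y \<in> K \<and> x * y \<in> K) \<and>
     (\<forall>x\<in>K. - x \<in> K \<and> inverse x \<in> K)"

text \<open>The trace is generic in the type, so that it applies both to field elements and
  to polynomials. Powers of a polynomial commute with evaluation, hence for \<open>P\<close> in \<open>'a poly\<close>
  the value of \<open>rel_trace q n P\<close> at \<open>x\<close> is \<open>rel_trace q n (poly P x)\<close>.\<close>

definition rel_trace :: "nat \<Rightarrow> nat \<Rightarrow> 'a::comm_semiring_1 \<Rightarrow> 'a" where
  "rel_trace q n x = (\<Sum>i<n. x ^ (q ^ i))"

text \<open>The compositional inverse is only determined modulo \<open>X^Q - X\<close>, where \<open>Q\<close> is the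
  order of the field, so it is rendered as a relation between polynomials.\<close>

definition is_comp_inverse :: "'a::finite_field poly \<Rightarrow> 'a poly \<Rightarrow> bool" where
  "is_comp_inverse f h \<longleftrightarrow>
     bij (poly f) \<and>
     [pcompose h f = [:0, 1:]] (mod ([:0, 1:] ^ CARD('a) - [:0, 1:])) \<and>
     [pcompose f h = [:0, 1:]] (mod ([:0, 1:] ^ CARD('a) - [:0, 1:]))"

definition trace_poly :: "nat \<Rightarrow> nat \<Rightarrow> 'a \<Rightarrow> 'a \<Rightarrow> 'a \<Rightarrow> 'a::field poly" where
  "trace_poly q n \<gamma> c1 c2 =
     (let X = [:0, 1:]
      in X + [:\<gamma>:] * rel_trace q n ([:c1:] * X + [:c2:] * X ^ 2 + X ^ 2 * rel_trace q n X))"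

definition trace_poly_inv :: "nat \<Rightarrow> nat \<Rightarrow> 'a \<Rightarrow> 'a \<Rightarrow> 'a \<Rightarrow> nat \<Rightarrow> 'a::field poly" where
  "trace_poly_inv q n \<gamma> c1 c2 t =
     (let X = [:0, 1:];
          c = c1 + c2 ^ 2;
          S = ([:c:] * rel_trace q n X + [:c2 ^ 3:]) ^ t
      in rel_trace q n ([:1 + \<gamma>:] * X) + [:\<gamma>:] * S + [:\<gamma> * c2:]
         + (\<Sum>(i, j) \<in> {(i, j). i \<in> {1..n-1} \<and> j \<in> {1..n-1} \<and> i \<noteq> j}.
              [:\<gamma> ^ (q ^ i):] * X ^ (q ^ j))
         + (\<Sum>j = 1..n-1. [:1 / c + 1:] * X ^ (q ^ j))
         + [:(1 / c + 1) * (\<Sum>j = 1..n-1. \<gamma> ^ (q ^ j)) + (c + 1) / c ^ 2:]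
           * ([:c:] * S + [:c:] * rel_trace q n X + [:c2 ^ 3 + c1 * c2:]))"

end

theory Submission
  imports Defs "HOL-Number_Theory.Residues"
begin

text \<open>Write \<open>s\<close> for the trace of \<open>x\<close>. Since the trace is \<open>K\<close>-linear and commutes with squaring,
  \<open>f(x) = x + \<gamma>(c1 s + c2 s\<^sup>2 + s\<^sup>3)\<close>. If \<open>Tr \<gamma> = 0\<close> then \<open>f\<close> preserves traces, and applying it twice
  adds the same correction twice. If \<open>Tr \<gamma> \<cdot> c = 1\<close> with \<open>c = c1 + c2\<^sup>2\<close>, then the trace of
  \<open>y = f(x)\<close> satisfies \<open>c Tr y + c2\<^sup>3 = (s + c2)\<^sup>3\<close>, so that the \<open>t\<close>-th power of the left-hand side is
  \<open>S = s + c2\<close>, and \<open>x = y + \<gamma> c (Tr y + S + c2)\<close>, which is what \<open>g(y)\<close> simplifies to.\<close>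

section \<open>Polynomial congruences and compositional inverses as statements about
  functions\<close>

lemma cong_power_CARD_iff:
  fixes p r :: "'a::finite_field poly"
  shows "[p = r] (mod ([:0, 1:] ^ CARD('a) - [:0, 1:])) \<longleftrightarrow> (\<forall>x. poly p x = poly r x)"
proof -
  define M :: "'a poly" where "M = [:0, 1:] ^ CARD('a) - [:0, 1:]"
  have M_eval: "poly M x = 0" for x
    by (simp add: M_def finite_field_power_card_eq_same)
  \<comment> \<open>At least two elements exist, so the power of X dominates the linear term of
    \<open>M\<close>.\<close>
  have "card {0, 1 :: 'a} \<le> CARD('a)"
    by (intro card_mono) auto
  hence "CARD('a) > 1"
    by simp
  hence deg_M: "degree M = CARD('a)"
    by (simp add: M_def diff_conv_add_uminus degree_add_eq_left degree_power_eq del: add_uminus_conv_diff)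
  hence "M \<noteq> 0"
    using \<open>CARD('a) > 1\<close> by auto
  \<comment> \<open>A nonzero remainder modulo \<open>M\<close> has degree below
    \<open>CARD('a)\<close>, too small for it to vanish at every field element.\<close>
  have "M dvd d" if "\<forall>x. poly d x = 0" for d
  proof -
    have "poly (d mod M) x = 0" for x
      using that M_eval by (metis add.right_neutral mult_zero_right poly_mult div_mult_mod_eq poly_add add.left_neutral)
    hence roots: "{x. poly (d mod M) x = 0} = UNIV"
      by simp
    have "d mod M = 0"
    proof (rule ccontr)
      assume nz: "d mod M \<noteq> 0"
      hence "CARD('a) \<le> degree (d mod M)"
        using card_poly_roots_bound[OF nz] by (simp add: roots)
      thus False
        using degree_mod_less[OF \<open>M \<noteq> 0\<close>, of d] nz deg_M by simp
    qed
    thus ?thesis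
      by (simp add: dvd_eq_mod_eq_0)
  qed
  moreover have "poly d x = 0" if "M dvd d" for d x
    using that M_eval by (auto simp: dvd_def)
  ultimately have "M dvd p - r \<longleftrightarrow> (\<forall>x. poly (p - r) x = 0)"
    by blast
  thus ?thesis
    by (simp add: cong_iff_dvd_diff M_def)
qed

text \<open>An injective self-map of a finite set is bijective, so a left inverse is automatically
  two-sided.\<close>

lemma is_comp_inverseI:
  fixes f h :: "'a::finite_field poly"
  assumes left: "\<And>x. poly h (poly f x) = x"
  shows "is_comp_inverse f h"
proof -
  have "inj (poly f)"
    using left by (metis injI)
  hence bij: "bij (poly f)"
    by (simp add: bij_def finite_UNIV_inj_surj)
  have "poly f (poly h y) = y" for y
    using left bij by (metis bij_pointE)
  thus ?thesis
    using left bij by (simp add: is_comp_inverse_def cong_power_CARD_iff poly_pcompose)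
qed

section \<open>Power maps on the subfield\<close>

lemma subfield_power_card:
  fixes K :: "'a::finite_field set"
  assumes "is_subfield K" and "x \<in> K"
  shows "x ^ card K = x"
proof (cases "x = 0")
  case True
  have "card K > 0"
    using assms by (auto simp: card_gt_0_iff)
  with True show ?thesis
    by simp
next
  case False
  have closed: "\<And>a b. a \<in> K \<Longrightarrow> b \<in> K \<Longrightarrow> a * b \<in> K" "\<And>a. a \<in> K \<Longrightarrow> inverse a \<in> K" "0 \<in> K"
    using assms(1) by (auto simp: is_subfield_def)
  \<comment> \<open>Fermat's argument: multiplication by \<open>x\<close> permutes the nonzero
    elements of \<open>K\<close>, and their product can then be cancelled.\<close>
  have "(\<Prod>y\<in>K - {0}. x * y) = \<Prod>(K - {0})"
    by (rule prod.reindex_bij_witness[of _ "\<lambda>y. inverse x * y" "\<lambda>y. x * y"])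
       (use False assms(2) closed in \<open>auto simp flip: mult.assoc\<close>)
  hence "x ^ (card K - 1) * \<Prod>(K - {0}) = 1 * \<Prod>(K - {0})"
    using closed(3) by (simp add: prod.distrib)
  hence "x ^ (card K - 1) = 1"
    by simp
  moreover have "card K > 0"
    using assms by (auto simp: card_gt_0_iff)
  ultimately show ?thesis
    by (metis Suc_diff_1 mult.right_neutral power_Suc)
qed

lemma power_fixed_power:
  fixes x :: "'a::monoid_mult"
  assumes "x ^ q = x"
  shows "x ^ (q ^ i) = x"
  by (induction i) (simp_all add: assms power_mult)

text \<open>With \<open>a = 3 * t\<close> this makes the \<open>t\<close>-th power undo cubing.
  Positivity of \<open>a\<close> handles \<open>x = 0\<close> and keeps the quotient
  \<open>k\<close> a natural number.\<close>

lemma power_cong_fixed: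
  fixes x :: "'a::field"
  assumes "x ^ q = x" and "q > 0" and "[a = 1] (mod (q - 1))" and "a > 0"
  shows "x ^ a = x"
proof (cases "x = 0")
  case False
  have "x * x ^ (q - 1) = x * 1"
    using assms(1,2) by (metis Suc_diff_1 mult.right_neutral power_Suc)
  hence "x ^ (q - 1) = 1"
    using False by simp
  moreover obtain k where "a = 1 + (q - 1) * k"
    using assms(3,4) by (metis Suc_eq_plus1_left Suc_leI One_nat_def cong_sym cong_le_nat mult.commute add.commute)
  ultimately show ?thesis
    by (simp add: power_mult)
qed (use assms in simp)

section \<open>Algebra of the relative trace\<close>

lemma rel_trace_smult:
  fixes a x :: "'a::comm_semiring_1"
  assumes "a ^ q = a"
  shows "rel_trace q n (a * x) = a * rel_trace q n x"
  by (simp add: rel_trace_def power_mult_distrib power_fixed_power[OF assms] sum_distrib_left)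

lemma rel_trace_power:
  fixes x :: "'a::comm_semiring_1"
  assumes "prime CHAR('a)" and "k = CHAR('a) ^ j"
  shows "rel_trace q n (x ^ k) = rel_trace q n x ^ k"
  by (simp add: rel_trace_def freshmans_dream_sum'[OF assms] mult.commute flip: power_mult)

lemma rel_trace_add:
  fixes x y :: "'a::comm_semiring_1"
  assumes "prime CHAR('a)" and "q = CHAR('a) ^ m"
  shows "rel_trace q n (x + y) = rel_trace q n x + rel_trace q n y"
  by (simp add: rel_trace_def sum.distrib freshmans_dream'[OF assms(1), of _ "m * i" for i] assms(2) flip: power_mult)

text \<open>The \<open>q\<close>-th power shifts the summands cyclically, the last one wrapping
  round to \<open>x\<close>. Traces can thus serve as scalars in
  \<open>rel_trace_smult\<close>.\<close>

lemma rel_trace_fixed: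
  fixes x :: "'a::comm_semiring_1"
  assumes "prime CHAR('a)" and "q = CHAR('a) ^ m" and "x ^ (q ^ n) = x"
  shows "rel_trace q n x ^ q = rel_trace q n x"
proof -
  have "rel_trace q n x ^ q = (\<Sum>i<n. x ^ (q ^ Suc i))"
    by (simp add: rel_trace_def freshmans_dream_sum'[OF assms(1,2)] mult.commute flip: power_mult)
  also have "\<dots> = rel_trace q n x"
  proof (cases n)
    case (Suc k)
    have "(\<Sum>i<n. x ^ (q ^ Suc i)) = (\<Sum>i<k. x ^ (q ^ Suc i)) + x"
      using assms(3) unfolding Suc sum.lessThan_Suc by simp
    also have "\<dots> = rel_trace q n x"
      unfolding rel_trace_def Suc sum.lessThan_Suc_shift by (simp add: add.commute)
    finally show ?thesis .
  qed (simp add: rel_trace_def)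
  finally show ?thesis .
qed

lemma rel_trace_split:
  assumes "n > 0"
  shows "rel_trace q n x = x + (\<Sum>j = 1..n-1. x ^ (q ^ j))"
proof -
  have "{..<n} = insert 0 {1..n-1}"
    using assms by auto
  thus ?thesis
    by (simp add: rel_trace_def)
qed

lemma poly_rel_trace [simp]: "poly (rel_trace q n p) x = rel_trace q n (poly p x)"
  by (simp add: rel_trace_def poly_sum)

text \<open>The double sum in the inverse leaves out \<open>i = j\<close>; once the diagonal is
  restored, it factors.\<close>

lemma sum_off_diagonal:
  fixes a b :: "'b \<Rightarrow> 'a::comm_semiring_1"
  assumes "finite I"
  shows "(\<Sum>(i, j) \<in> {(i, j). i \<in> I \<and> j \<in> I \<and> i \<noteq> j}. a i * b j) + (\<Sum>i\<in>I. a i * b i) = sum a I * sum b I"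
proof -
  let ?off = "{(i, j). i \<in> I \<and> j \<in> I \<and> i \<noteq> j}" and ?diag = "(\<lambda>i. (i, i)) ` I"
  have union: "I \<times> I = ?off \<union> ?diag" and disj: "?off \<inter> ?diag = {}"
    by auto
  have "finite (?off \<union> ?diag)"
    unfolding union[symmetric] using assms by blast
  hence fin: "finite ?off" "finite ?diag"
    by simp_all
  have diag: "(\<Sum>(i, j)\<in>?diag. a i * b j) = (\<Sum>i\<in>I. a i * b i)"
    by (subst sum.reindex) (auto simp: inj_on_def)
  have "sum a I * sum b I = (\<Sum>(i, j)\<in>I \<times> I. a i * b j)"
    by (simp add: sum_product sum.cartesian_product)
  also have "\<dots> = (\<Sum>(i, j)\<in>?off. a i * b j) + (\<Sum>i\<in>I. a i * b i)"
    unfolding union sum.union_disjoint[OF fin disj] diag ..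
  finally show ?thesis ..
qed

section \<open>Values of both polynomials in characteristic 2\<close>

lemma CHAR_2_add_self:
  fixes x :: "'a::comm_semiring_1"
  assumes "CHAR('a) = 2"
  shows "x + x = 0" and "x + (x + y) = y"
proof -
  have "(2::'a) = 0"
    using of_nat_CHAR[where ?'a = 'a] by (simp add: assms)
  thus "x + x = 0"
    by (metis mult_2 mult_zero_left)
  thus "x + (x + y) = y"
    by (simp flip: add.assoc)
qed

text \<open>The inner trace \<open>s\<close> is fixed by the \<open>q\<close>-th power, so it leaves
  the outer trace as a scalar and the last term contributes \<open>s ^ 2 * s\<close>.\<close>

lemma poly_trace_poly:
  fixes \<gamma> c1 c2 x :: "'a::field"
  assumes char: "CHAR('a) = 2" and q: "q = 2 ^ m" and x: "x ^ (q ^ n) = x"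
    and c: "c1 ^ q = c1" "c2 ^ q = c2"
  defines "s \<equiv> rel_trace q n x"
  shows "poly (trace_poly q n \<gamma> c1 c2) x = x + \<gamma> * (c1 * s + c2 * s ^ 2 + s ^ 3)"
proof -
  have prime: "prime CHAR('a)" and q': "q = CHAR('a) ^ m"
    by (simp_all add: char q)
  have s: "s ^ q = s"
    unfolding s_def by (rule rel_trace_fixed[OF prime q' x])
  have sq: "rel_trace q n (x ^ 2) = s ^ 2"
    unfolding s_def by (rule rel_trace_power[OF prime, of _ 1]) (simp add: char)
  have "rel_trace q n (c1 * x + c2 * x ^ 2 + x ^ 2 * s) = c1 * s + c2 * s ^ 2 + s ^ 2 * s"
    by (simp add: rel_trace_add[OF prime q'] rel_trace_smult[OF c(1)] rel_trace_smult[OF c(2)]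
        rel_trace_smult[OF s] sq mult.commute[of _ s] flip: s_def)
  moreover have "poly (trace_poly q n \<gamma> c1 c2) x = x + \<gamma> * rel_trace q n (c1 * x + c2 * x ^ 2 + x ^ 2 * s)"
    by (simp add: trace_poly_def Let_def s_def algebra_simps power2_eq_square)
  ultimately show ?thesis
    by (simp add: power2_eq_square power3_eq_cube)
qed

lemma poly_trace_poly_inv:
  fixes \<gamma> c1 c2 y :: "'a::field"
    and t :: nat
  assumes char: "CHAR('a) = 2" and q: "q = 2 ^ m" and n: "n > 0"
    and inv: "rel_trace q n \<gamma> * (c1 + c2 ^ 2) = 1"
  defines "c \<equiv> c1 + c2 ^ 2"
  defines "S \<equiv> (c * rel_trace q n y + c2 ^ 3) ^ t"
  shows "poly (trace_poly_inv q n \<gamma> c1 c2 t) y = y + \<gamma> * c * (rel_trace q n y + S + c2)"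
proof -
  have prime: "prime CHAR('a)" and q': "q = CHAR('a) ^ m"
    by (simp_all add: char q)
  note add_self = CHAR_2_add_self[OF char]
  define I where "I = {1..n-1}"
  define e where "e = rel_trace q n \<gamma>"
  define \<tau> where "\<tau> = rel_trace q n y"
  define a where "a = (\<Sum>i\<in>I. \<gamma> ^ (q ^ i))"
  define b where "b = (\<Sum>j\<in>I. y ^ (q ^ j))"
  define off where
    "off = (\<Sum>(i, j) \<in> {(i, j). i \<in> I \<and> j \<in> I \<and> i \<noteq> j}. \<gamma> ^ (q ^ i) * y ^ (q ^ j))"
  define diag where "diag = (\<Sum>i\<in>I. \<gamma> ^ (q ^ i) * y ^ (q ^ i))"
  have ec: "e * c = 1"
    using inv by (simp add: e_def c_def)
  hence inv_c: "1 / c = e"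
    by (metis nonzero_eq_divide_eq mult_zero_right zero_neq_one)
  have e: "e = \<gamma> + a" and \<tau>: "\<tau> = y + b"
    by (simp_all add: e_def \<tau>_def a_def b_def I_def rel_trace_split[OF n])
  \<comment> \<open>This trace supplies exactly the diagonal missing from
    \<open>off\<close>.\<close>
  have "rel_trace q n (\<gamma> * y) = \<gamma> * y + diag"
    by (simp add: rel_trace_split[OF n] diag_def I_def power_mult_distrib)
  hence "rel_trace q n ((1 + \<gamma>) * y) = \<tau> + \<gamma> * y + diag"
    by (simp add: distrib_right rel_trace_add[OF prime q'] \<tau>_def add.assoc)
  hence "poly (trace_poly_inv q n \<gamma> c1 c2 t) y =
      (\<tau> + \<gamma> * y + diag) + \<gamma> * S + \<gamma> * c2 + off + (\<Sum>j\<in>I. (1 / c + 1) * y ^ (q ^ j))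
      + ((1 / c + 1) * a + (c + 1) / c ^ 2) * (c * S + c * \<tau> + (c2 ^ 3 + c1 * c2))"
    by (simp add: trace_poly_inv_def Let_def poly_sum case_prod_beta off_def a_def S_def \<tau>_def
        I_def mult.commute flip: c_def)
  also have "(\<Sum>j\<in>I. (1 / c + 1) * y ^ (q ^ j)) = (e + 1) * b"
    by (simp add: b_def sum_distrib_left inv_c)
  also have "(c + 1) / c ^ 2 = (c * e) * e + e * e"
    by (simp add: power2_eq_square add_divide_distrib flip: inv_c)
  also have "c * e = 1"
    using ec by (simp add: mult.commute)
  \<comment> \<open>The left side is \<open>(e + 1) * (a + e)\<close>, and
    \<open>a + e = \<gamma>\<close> in characteristic 2.\<close>
  also have "(1 / c + 1) * a + (1 * e + e * e) = (e + 1) * \<gamma>"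
    unfolding inv_c by (simp add: e algebra_simps add_self)
  also have "c2 ^ 3 + c1 * c2 = c * c2"
    by (simp add: c_def algebra_simps power2_eq_square power3_eq_cube)
  also have "(\<tau> + \<gamma> * y + diag) + \<gamma> * S + \<gamma> * c2 + off + (e + 1) * b
      + (e + 1) * \<gamma> * (c * S + c * \<tau> + c * c2)
    = (\<tau> + \<gamma> * y + (off + diag) + (e + 1) * b) + \<gamma> * (S + c2)
      + (e * c + c) * \<gamma> * (\<tau> + S + c2)"
    by (simp add: algebra_simps)
  also have "off + diag = a * b"
    unfolding off_def diag_def a_def b_def by (rule sum_off_diagonal) (simp add: I_def)
  \<comment> \<open>Expanding \<open>e * b\<close> yields a second \<open>a * b\<close>, which
    cancels; moreover \<open>\<tau> + b = y\<close> and
    \<open>\<gamma> * (y + b) = \<gamma> * \<tau>\<close>.\<close>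
  also have "\<tau> + \<gamma> * y + a * b + (e + 1) * b = y + \<gamma> * \<tau>"
    by (simp add: e \<tau> algebra_simps add_self)
  also have "y + \<gamma> * \<tau> + \<gamma> * (S + c2) + (e * c + c) * \<gamma> * (\<tau> + S + c2) = y + \<gamma> * c * (\<tau> + S + c2)"
    unfolding ec by (simp add: algebra_simps add_self)
  finally show ?thesis
    by (simp add: \<tau>_def)
qed

theorem proposition4p8:
  fixes m n q :: nat
    and K :: "'a::finite_field set"
    and \<gamma> c1 c2 :: 'a
  assumes "m > 0" and "n > 0" and "q = 2 ^ m"
    and "CARD('a) = q ^ n"
    and "is_subfield K" and "card K = q"
    and "c1 \<in> K" and "c2 \<in> K"
  shows "(rel_trace q n \<gamma> = 0 \<longrightarrow>
            is_comp_inverse (trace_poly q n \<gamma> c1 c2) (trace_poly q n \<gamma> c1 c2)) \<and>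
         (rel_trace q n \<gamma> * (c1 + c2 ^ 2) = 1 \<and> odd m \<longrightarrow>
            (\<forall>t::nat. t > 0 \<and> [3 * t = 1] (mod (2 ^ m - 1)) \<longrightarrow>
               is_comp_inverse (trace_poly q n \<gamma> c1 c2) (trace_poly_inv q n \<gamma> c1 c2 t)))"
proof -
  have prime: "prime CHAR('a)"
    by (rule prime_CHAR_semidom) (rule CHAR_pos)
  have "CHAR('a) dvd 2 ^ (m * n)"
    using CHAR_dvd_CARD[where ?'a = 'a] assms(3,4) by (simp add: power_mult)
  hence char: "CHAR('a) = 2"
    using prime by (metis prime_dvd_power primes_dvd_imp_eq two_is_prime_nat)
  note add_self = CHAR_2_add_self[OF char]
  have q': "q = CHAR('a) ^ m"
    using assms(3) char by simp
  \<comment> \<open>Membership in \<open>K\<close> enters only through these fixed-point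
    equations.\<close>
  have c: "c1 ^ q = c1" "c2 ^ q = c2"
    using subfield_power_card[OF assms(5)] assms(6-8) by auto
  have x: "x ^ (q ^ n) = x" for x :: 'a
    using finite_field_power_card_eq_same[of x] assms(4) by simp
  define u where "u s = c1 * s + c2 * s ^ 2 + s ^ 3" for s
  define f where "f = poly (trace_poly q n \<gamma> c1 c2)"
  have f: "f x = x + \<gamma> * u (rel_trace q n x)" for x
    unfolding f_def u_def by (rule poly_trace_poly[OF char assms(3) x c])
  have tr_fixed: "rel_trace q n x ^ q = rel_trace q n x" for x :: 'a
    by (rule rel_trace_fixed[OF prime q' x])
  \<comment> \<open>This lets the correction \<open>u s\<close> be pulled out of the trace in
    \<open>tr_f\<close>.\<close>
  have u_fixed: "u s ^ q = u s" if "s ^ q = s" for s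
    unfolding u_def
    by (simp add: freshmans_dream'[OF prime q'] power_mult_distrib c that
        power_commutes[symmetric] power2_eq_square power3_eq_cube)
  have tr_f: "rel_trace q n (f x) = rel_trace q n x + u (rel_trace q n x) * rel_trace q n \<gamma>" for x
    unfolding f
    by (simp add: rel_trace_add[OF prime q'] rel_trace_smult[OF u_fixed[OF tr_fixed]] mult.commute[of \<gamma>])
  show ?thesis
  proof (intro conjI impI allI)
    assume "rel_trace q n \<gamma> = 0"
    hence "f (f x) = x" for x
      by (simp add: f[of "f x"] tr_f) (simp add: f add.assoc add_self)
    thus "is_comp_inverse (trace_poly q n \<gamma> c1 c2) (trace_poly q n \<gamma> c1 c2)"
      unfolding f_def by (rule is_comp_inverseI)
  next
    fix t :: nat
    assume inv: "rel_trace q n \<gamma> * (c1 + c2 ^ 2) = 1 \<and> odd m"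
      and t: "t > 0 \<and> [3 * t = 1] (mod (2 ^ m - 1))"
    show "is_comp_inverse (trace_poly q n \<gamma> c1 c2) (trace_poly_inv q n \<gamma> c1 c2 t)"
    proof (rule is_comp_inverseI, fold f_def)
      fix x :: 'a
      define s where "s = rel_trace q n x"
      define c where "c = c1 + c2 ^ 2"
      define \<tau> where "\<tau> = rel_trace q n (f x)"
      have ce: "rel_trace q n \<gamma> * c = 1"
        using inv by (simp add: c_def)
      have "c * \<tau> = c * s + u s * (rel_trace q n \<gamma> * c)"
        unfolding \<tau>_def tr_f by (simp add: s_def algebra_simps)
      hence c\<tau>: "c * \<tau> = c * s + u s"
        by (simp add: ce)
      \<comment> \<open>The two copies of \<open>c1 * s\<close> cancel, and the binomial
        coefficients 3 equal 1, leaving a perfect cube.\<close>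
      hence "c * \<tau> + c2 ^ 3 = (s + c2) ^ 3"
        by (simp add: c_def u_def algebra_simps power2_eq_square power3_eq_cube add_self)
      hence "(c * \<tau> + c2 ^ 3) ^ t = (s + c2) ^ (3 * t)"
        by (simp add: power_mult)
      also have "\<dots> = s + c2"
      proof (rule power_cong_fixed)
        show "(s + c2) ^ q = s + c2"
          by (simp add: freshmans_dream'[OF prime q'] c s_def tr_fixed)
      qed (use t assms(3) in auto)
      finally have "poly (trace_poly_inv q n \<gamma> c1 c2 t) (f x) = f x + \<gamma> * c * (\<tau> + (s + c2) + c2)"
        using poly_trace_poly_inv[OF char assms(3,2) conjunct1[OF inv], of t "f x"]
        by (simp add: c_def \<tau>_def)
      also have "\<dots> = f x + \<gamma> * (c * \<tau> + c * s)"
        by (simp add: algebra_simps add_self)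
      \<comment> \<open>Here \<open>c * \<tau> + c * s\<close> is \<open>u s\<close>, so the
        correction added by \<open>f\<close> is added once more and vanishes.\<close>
      also have "\<dots> = x"
        unfolding c\<tau> f s_def[symmetric] by (simp add: algebra_simps add_self)
      finally show "poly (trace_poly_inv q n \<gamma> c1 c2 t) (f x) = x" .
    qed
  qed
qed

end
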